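(* Let $\mathcal{P}=\{\bm x\in\mathbb{R}^K:\bm S\bm x\le\bm t\}$ with $\bm S\in\mathbb{R}^{J\times K}$ and $\bm t\in\mathbb{R}^J$, and assume $\mathcal{P}$ is compact, convex and full-dimensional. Let $\bm A\in\mathbb{S}^K_{++}$ and $\bm b\in\mathbb{R}^K$. Then the ellipsoid $\mathcal{E}(\bm A,\bm b)=\{\bm x\in\mathbb{R}^K:\|\bm A\bm x+\bm b\|^2\le1\}$ contains $\mathcal{P}$ if there exist $\bm N\in\mathbb{R}_+^{J\times J}$, $\bm F\in\mathbb{S}^K$, $\bm g\in\mathbb{R}^K$, $h\in\mathbb{R}$ such that $$\begin{bmatrix}\bm F&\bm g\\ \bm g^\top&h-1\end{bmatrix}\preceq-\begin{bmatrix}-\bm S^\top\\ \bm t^\top\end{bmatrix}\bm N\begin{bmatrix}-\bm S&\bm t\end{bmatrix}\quad\text{and}\quad\begin{bmatrix}\bm F&\bm g&\bm A\\ \bm g^\top&h&\bm b^\top\\ \bm A&\bm b&\mathbb{I}\end{bmatrix}\succeq\bm 0.$$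
   Context: $\mathbb{S}^K$ and $\mathbb{S}^K_{++}$ are the sets of real symmetric and symmetric positive definite $K\times K$ matrices; $\mathbb{R}_+^{J\times J}$ is the set of entrywise nonnegative matrices; $\mathbb{I}$ is the identity matrix; $\|\cdot\|$ is the Euclidean norm. Vector inequalities are componentwise. $\bm P\succeq\bm Q$ (equivalently $\bm Q\preceq\bm P$) means that $\bm P-\bm Q$ is symmetric positive semidefinite. Full-dimensional means having nonempty interior. *)

theory Defs
  imports "HOL-Analysis.Analysis"
begin

definition symmetric_mat :: "real^'n^'n \<Rightarrow> bool"
  where "symmetric_mat M \<longleftrightarrow> transpose M = M"

definition psd_mat :: "real^'n^'n \<Rightarrow> bool"
  where "psd_mat M \<longleftrightarrow> symmetric_mat M \<and> (\<forall>x. 0 \<le> x \<bullet> (M *v x))"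

definition pd_mat :: "real^'n^'n \<Rightarrow> bool"
  where "pd_mat M \<longleftrightarrow> symmetric_mat M \<and> (\<forall>x. x \<noteq> 0 \<longrightarrow> 0 < x \<bullet> (M *v x))"

(* The Loewner order; the library's \<le> on real^'n^'n is the entrywise order instead.
   Symmetry is only required of the difference. *)
definition loewner_le :: "real^'n^'n \<Rightarrow> real^'n^'n \<Rightarrow> bool"  (infix "\<preceq>" 50)
  where "P \<preceq> Q \<longleftrightarrow> psd_mat (Q - P)"

(* Block matrices are indexed by disjoint sums: hblock A B is [A B], and vblock A B is A stacked
   on top of B. Vectors and scalars become blocks through columnvector / rowvector / mat with the
   one-element index type 1. *)
definition hblock :: "real^'a^'m \<Rightarrow> real^'b^'m \<Rightarrow> real^('a + 'b)^'m"
  where "hblock A B = (\<chi> i j. case j of Inl a \<Rightarrow> A $ i $ a | Inr b \<Rightarrow> B $ i $ b)"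

definition vblock :: "real^'a^'m \<Rightarrow> real^'a^'n \<Rightarrow> real^'a^('m + 'n)"
  where "vblock A B = (\<chi> i. case i of Inl m \<Rightarrow> A $ m | Inr n \<Rightarrow> B $ n)"

definition ineq_polyhedron :: "real^'k^'j \<Rightarrow> real^'j \<Rightarrow> (real^'k) set"
  where "ineq_polyhedron S t = {x. \<forall>i. (S *v x) $ i \<le> t $ i}"

definition ellipsoid :: "real^'k^'k \<Rightarrow> real^'k \<Rightarrow> (real^'k) set"
  where "ellipsoid A b = {x. (norm (A *v x + b))\<^sup>2 \<le> 1}"

end

theory Submission
  imports Defs
begin

text \<open>
  Test the first matrix inequality on \<open>(x, 1)\<close> and the second on \<open>(x, 1, -y)\<close> with \<open>y = A x + b\<close>.
  For \<open>x\<close> in the polyhedron the slack \<open>t - S x\<close> is nonnegative, so these give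
  \<open>x\<^sup>T F x + 2 g\<^sup>T x + h - 1 \<le> - (t - S x)\<^sup>T N (t - S x) \<le> 0\<close> and
  \<open>0 \<le> x\<^sup>T F x + 2 g\<^sup>T x + h - y\<^sup>T y\<close>.
\<close>

text \<open>The vector counterpart of \<open>vblock\<close>: it uses the same sum index type, so
  block matrices act on it block by block.\<close>

definition vjoin :: "'c^'a \<Rightarrow> 'c^'b \<Rightarrow> 'c^('a + 'b)"
  where "vjoin x y = (\<chi> i. case i of Inl a \<Rightarrow> x $ a | Inr b \<Rightarrow> y $ b)"

lemma sum_UNIV_Plus:
  fixes f :: "'a::finite + 'b::finite \<Rightarrow> 'c::comm_monoid_add"
  shows "sum f UNIV = (\<Sum>a\<in>UNIV. f (Inl a)) + (\<Sum>b\<in>UNIV. f (Inr b))"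
  unfolding UNIV_Plus_UNIV [symmetric] by (subst sum.Plus) (simp_all add: o_def)

lemma inner_vjoin:
  fixes x u :: "real^'a" and y v :: "real^'b"
  shows "vjoin x y \<bullet> vjoin u v = x \<bullet> u + y \<bullet> v"
  by (simp add: inner_vec_def vjoin_def sum_UNIV_Plus)

lemma hblock_mult_vjoin: "hblock A B *v vjoin x y = A *v x + B *v y"
  by (simp add: vec_eq_iff matrix_vector_mult_def hblock_def vjoin_def sum_UNIV_Plus)

lemma vblock_mult: "vblock A B *v x = vjoin (A *v x) (B *v x)"
  by (auto simp: vec_eq_iff matrix_vector_mult_def vblock_def vjoin_def split: sum.split)

lemma columnvector_mult: "columnvector v *v (y :: real^1) = (y $ 1) *\<^sub>R (v :: real^'n)"
  by (simp add: vec_eq_iff matrix_vector_mult_def columnvector_def)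

lemma rowvector_mult: "(rowvector v :: real^'n^1) *v x = vec (v \<bullet> x)"
  by (simp add: vec_eq_iff matrix_vector_mult_def rowvector_def inner_vec_def)

lemma mat_mult_vec: "mat c *v x = c *\<^sub>R (x :: real^'n)"
  by (simp add: vec_eq_iff matrix_vector_mult_def mat_def if_distrib if_distribR cong: if_cong)

lemma uminus_matrix_mult_vec: "(- M) *v x = - (M *v (x :: real^'n))"
  by (simp add: vec_eq_iff matrix_vector_mult_def sum_negf)

lemma inner_vec_1: "(u :: real^1) \<bullet> v = u $ 1 * v $ 1"
  by (simp add: inner_vec_def)

text \<open>Together these reduce the quadratic form of a block matrix at a joined vector to inner
  products of the individual blocks.\<close>

lemmas block_simps = inner_vjoin hblock_mult_vjoin vblock_mult columnvector_mult rowvector_mult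
  mat_mult_vec uminus_matrix_mult_vec inner_vec_1

lemma loewner_le_quadratic_form:
  assumes "P \<preceq> Q"
  shows "x \<bullet> (P *v x) \<le> x \<bullet> (Q *v x)"
  using assms
  by (simp add: loewner_le_def psd_mat_def matrix_vector_mult_diff_rdistrib inner_diff_right)

text \<open>The sign comes from the entries rather than from definiteness: each product
  \<open>u $ i * N $ i $ j * v $ j\<close> is nonnegative.\<close>

lemma nonneg_matrix_inner_nonneg:
  fixes N :: "real^'n^'m"
  assumes "\<And>i j. 0 \<le> N $ i $ j" and "\<And>i. 0 \<le> u $ i" and "\<And>j. 0 \<le> v $ j"
  shows "0 \<le> u \<bullet> (N *v v)"
  using assms by (auto simp: inner_vec_def matrix_vector_mult_def intro!: sum_nonneg mult_nonneg_nonneg)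

text \<open>The right factor [-S t] sends (x, 1) to the slack t - S x, and the left factor is its
  transpose, so the form of \<open>N\<close> is pulled back to the slack.\<close>

lemma quadratic_form_lifted_slack:
  fixes S :: "real^'k^'j" and t :: "real^'j"
  shows "vjoin x (vec 1) \<bullet> ((vblock (- transpose S) (rowvector t :: real^'j^1) ** N
           ** hblock (- S) (columnvector t :: real^1^'j)) *v vjoin x (vec 1))
         = (t - S *v x) \<bullet> (N *v (t - S *v x))"
proof -
  \<comment> \<open>With this vector fixed, only the transposed left factor has to be moved across
    the inner product.\<close>
  define w where "w = N *v (t - S *v x)"
  have "x \<bullet> (transpose S *v w) = (S *v x) \<bullet> w"
    by (metis dot_lmul_matrix inner_commute transpose_matrix_vector)
  moreover have "(- S) *v x + columnvector t *v (vec 1 :: real^1) = t - S *v x"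
    by (simp add: block_simps)
  ultimately show ?thesis
    by (simp add: matrix_vector_mul_assoc [symmetric] block_simps w_def [symmetric] inner_diff_left)
qed

theorem theorem2:
  fixes S :: "real^'k^'j" and t :: "real^'j" and A :: "real^'k^'k" and b :: "real^'k"
  assumes "compact (ineq_polyhedron S t)"
    and "convex (ineq_polyhedron S t)"
    and "interior (ineq_polyhedron S t) \<noteq> {}"
    and "pd_mat A"
    and "\<exists>(N :: real^'j^'j) (F :: real^'k^'k) (g :: real^'k) (h :: real).
      (\<forall>i j. 0 \<le> N $ i $ j) \<and> symmetric_mat F \<and>
      vblock (hblock F (columnvector g))
             (hblock (rowvector g) (mat (h - 1) :: real^1^1))
        \<preceq> - (vblock (- transpose S) (rowvector t :: real^'j^1) ** N
                ** hblock (- S) (columnvector t :: real^1^'j)) \<and>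
      0 \<preceq> vblock (hblock F (hblock (columnvector g) A))
           (vblock (hblock (rowvector g) (hblock (mat h :: real^1^1) (rowvector b)))
                   (hblock A (hblock (columnvector b) (mat 1))))"
  shows "ineq_polyhedron S t \<subseteq> ellipsoid A b"
proof
  fix x assume "x \<in> ineq_polyhedron S t"
  then have slack: "\<And>i. 0 \<le> (t - S *v x) $ i"
    by (simp add: ineq_polyhedron_def)
  from assms(5) obtain N :: "real^'j^'j" and F :: "real^'k^'k" and g :: "real^'k" and h :: real
    where N: "\<And>i j. 0 \<le> N $ i $ j"
      and upper: "vblock (hblock F (columnvector g))
             (hblock (rowvector g) (mat (h - 1) :: real^1^1))
        \<preceq> - (vblock (- transpose S) (rowvector t :: real^'j^1) ** N
                ** hblock (- S) (columnvector t :: real^1^'j))"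
      and lower: "0 \<preceq> vblock (hblock F (hblock (columnvector g) A))
           (vblock (hblock (rowvector g) (hblock (mat h :: real^1^1) (rowvector b)))
                   (hblock A (hblock (columnvector b) (mat 1))))"
    by blast
  \<comment> \<open>The vector z = -y minimises z \<bullet> z + 2 z \<bullet> (A x + b), the part of
    the second quadratic form at (x, 1, z) that depends on z; this is the Schur complement
    argument.\<close>
  define y where "y = A *v x + b"
  have "x \<bullet> (F *v x) + 2 * (g \<bullet> x) + h - 1 \<le> - ((t - S *v x) \<bullet> (N *v (t - S *v x)))"
    using loewner_le_quadratic_form [OF upper, of "vjoin x (vec 1)"]
    unfolding uminus_matrix_mult_vec inner_minus_right quadratic_form_lifted_slack
    by (simp add: block_simps inner_add_right inner_commute)
  moreover have "0 \<le> (t - S *v x) \<bullet> (N *v (t - S *v x))"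
    using N slack by (rule nonneg_matrix_inner_nonneg) (rule slack)
  moreover have "0 \<le> x \<bullet> (F *v x) + 2 * (g \<bullet> x) + h - y \<bullet> y"
  proof -
    \<comment> \<open>One off-diagonal block \<open>A\<close> acts on x, the other on y; symmetry
      identifies the two cross terms.\<close>
    have "transpose A = A"
      using assms(4) by (simp add: pd_mat_def symmetric_mat_def)
    then have "x \<bullet> (A *v y) = (A *v x) \<bullet> y"
      by (metis dot_lmul_matrix vector_transpose_matrix)
    then have "x \<bullet> (A *v y) + b \<bullet> y = y \<bullet> y"
      by (simp add: y_def inner_add_left)
    moreover have "A *v (- y) = - (A *v y)"
      by (simp add: vec_eq_iff matrix_vector_mult_def sum_negf)
    \<comment> \<open>The third block row vanishes at (x, 1, -y), so y survives only in the cross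
      terms of the first two rows, which add up to -(y \<bullet> y).\<close>
    moreover have "A *v x + (b - y) = 0"
      by (simp add: y_def)
    ultimately show ?thesis
      using loewner_le_quadratic_form [OF lower, of "vjoin x (vjoin (vec 1) (- y))"]
      by (simp add: block_simps inner_add_right inner_diff_right inner_commute)
  qed
  ultimately have "y \<bullet> y \<le> 1"
    by linarith
  then show "x \<in> ellipsoid A b"
    by (simp add: ellipsoid_def y_def power2_norm_eq_inner)
qed

end
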